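(* Let $p$ be a prime with $p\equiv 11\pmod{12}$, and let $G$ be the Eberhard graph with parameter $p$. Then $\overline{G}$ has a model of $K_{\chi(\overline{G})}$ in which every branch set has at most two vertices.
   Context: For a prime $p\equiv 11\pmod{12}$, let $S=\{(x,x^2),(x,-x^2): x\in\mathbb{F}_p\setminus\{0\}\}\subseteq\mathbb{F}_p\times\mathbb{F}_p$. The Eberhard graph with parameter $p$ is the Cayley graph with vertex set $\mathbb{F}_p\times\mathbb{F}_p$ in which $u$ and $v$ are adjacent iff $u-v\in S$. $\overline{G}$ denotes the complement. A model of $K_t$ in a graph is a collection of $t$ pairwise disjoint vertex sets (branch sets), each inducing a connected subgraph, with an edge between every two of them. *)

theory Defs
  imports "HOL-Number_Theory.Residues" "Graph_Theory.Graph_Theory"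
begin

text \<open>
  Simple graphs are represented, as in \<open>Graph_Theory\<close>, by loop-free symmetric sets of
  arcs (locale \<open>pair_graph\<close>).
\<close>

definition complement_graph :: "'a pair_pre_digraph \<Rightarrow> 'a pair_pre_digraph" where
  "complement_graph G =
    \<lparr> pverts = pverts G,
      parcs = {(u, v). u \<in> pverts G \<and> v \<in> pverts G \<and> u \<noteq> v \<and> (u, v) \<notin> parcs G} \<rparr>"

definition proper_colouring :: "'a pair_pre_digraph \<Rightarrow> nat \<Rightarrow> ('a \<Rightarrow> nat) \<Rightarrow> bool" where
  "proper_colouring G k c \<longleftrightarrow>
    (\<forall>v \<in> pverts G. c v < k) \<and> (\<forall>(u, v) \<in> parcs G. c u \<noteq> c v)"

definition chromatic_number :: "'a pair_pre_digraph \<Rightarrow> nat" where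
  "chromatic_number G = (LEAST k. \<exists>c. proper_colouring G k c)"

text \<open>
  The predicate \<open>connected\<close> of \<open>Graph_Theory\<close> is false for the graph without vertices, so
  branch sets are nonempty.
\<close>

definition complete_model :: "'a pair_pre_digraph \<Rightarrow> nat \<Rightarrow> 'a set set \<Rightarrow> bool" where
  "complete_model G t \<B> \<longleftrightarrow>
    finite \<B> \<and> card \<B> = t \<and>
    (\<forall>B \<in> \<B>. B \<subseteq> pverts G \<and> connected (with_proj G \<restriction> B)) \<and>
    (\<forall>B \<in> \<B>. \<forall>C \<in> \<B>. B \<noteq> C \<longrightarrow>
      B \<inter> C = {} \<and> (\<exists>u \<in> B. \<exists>v \<in> C. (u, v) \<in> parcs G))"

definition eberhard_set :: "nat \<Rightarrow> (int \<times> int) set" where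
  "eberhard_set p = (let F = residue_ring (int p) in
    {(x, x [^]\<^bsub>F\<^esub> (2::nat)) | x. x \<in> carrier F - {\<zero>\<^bsub>F\<^esub>}} \<union>
    {(x, \<ominus>\<^bsub>F\<^esub> (x [^]\<^bsub>F\<^esub> (2::nat))) | x. x \<in> carrier F - {\<zero>\<^bsub>F\<^esub>}})"

definition eberhard_graph :: "nat \<Rightarrow> (int \<times> int) pair_pre_digraph" where
  "eberhard_graph p = (let F = residue_ring (int p); V = carrier F \<times> carrier F in
    \<lparr> pverts = V,
      parcs = {(u, v). u \<in> V \<and> v \<in> V \<and>
        (fst u \<ominus>\<^bsub>F\<^esub> fst v, snd u \<ominus>\<^bsub>F\<^esub> snd v) \<in> eberhard_set p} \<rparr>)"

lemma pair_graph_complement_graph: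
  assumes "pair_graph G"
  shows "pair_graph (complement_graph G)"
proof -
  interpret pair_graph G by fact
  have "finite (parcs (complement_graph G))"
    by (rule finite_subset[of _ "pverts G \<times> pverts G"])
      (auto simp: complement_graph_def pair_finite_verts)
  moreover have "symmetric (with_proj (complement_graph G))"
    using pair_sym_arcs
    by (auto simp: symmetric_def complement_graph_def sym_def)
  ultimately show ?thesis
    by unfold_locales (auto simp: complement_graph_def pair_finite_verts)
qed

lemma pair_graph_eberhard_graph:
  assumes "1 < p"
  shows "pair_graph (eberhard_graph p)"
proof -
  define F where "F = residue_ring (int p)"
  interpret residues "int p" F
    using assms by unfold_locales (simp_all add: F_def)
  interpret cring F by (rule cring)
  have S: "eberhard_set p =
      {(x, x [^]\<^bsub>F\<^esub> (2::nat)) | x. x \<in> carrier F - {\<zero>\<^bsub>F\<^esub>}} \<union>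
      {(x, \<ominus>\<^bsub>F\<^esub> (x [^]\<^bsub>F\<^esub> (2::nat))) | x. x \<in> carrier F - {\<zero>\<^bsub>F\<^esub>}}"
    by (simp add: eberhard_set_def F_def Let_def)
  have V: "pverts (eberhard_graph p) = carrier F \<times> carrier F"
    by (simp add: eberhard_graph_def F_def Let_def)
  have A: "parcs (eberhard_graph p) =
      {(u, v). u \<in> carrier F \<times> carrier F \<and> v \<in> carrier F \<times> carrier F \<and>
        (fst u \<ominus>\<^bsub>F\<^esub> fst v, snd u \<ominus>\<^bsub>F\<^esub> snd v) \<in> eberhard_set p}"
    by (simp add: eberhard_graph_def F_def Let_def)
  have fin: "finite (carrier F)"
    by (simp add: F_def residue_ring_def)
  have sq: "(\<ominus>\<^bsub>F\<^esub> x) [^]\<^bsub>F\<^esub> (2::nat) = x [^]\<^bsub>F\<^esub> (2::nat)" if "x \<in> carrier F" for x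
    using that by (simp add: numeral_2_eq_2 l_minus r_minus)
  have neg: "(\<ominus>\<^bsub>F\<^esub> x, \<ominus>\<^bsub>F\<^esub> y) \<in> eberhard_set p"
    if "(x, y) \<in> eberhard_set p" for x y
  proof -
    have x: "x \<in> carrier F" "x \<noteq> \<zero>\<^bsub>F\<^esub>"
      and y: "y = x [^]\<^bsub>F\<^esub> (2::nat) \<or> y = \<ominus>\<^bsub>F\<^esub> (x [^]\<^bsub>F\<^esub> (2::nat))"
      using that by (auto simp: S)
    have "\<ominus>\<^bsub>F\<^esub> x \<noteq> \<zero>\<^bsub>F\<^esub>"
      using x by (metis minus_minus minus_zero)
    then show ?thesis
      using x y sq[OF x(1)] by (auto simp: S)
  qed
  have diff: "b \<ominus>\<^bsub>F\<^esub> a = \<ominus>\<^bsub>F\<^esub> (a \<ominus>\<^bsub>F\<^esub> b)"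
    if "a \<in> carrier F" "b \<in> carrier F" for a b
    using that by (simp add: minus_eq minus_add a_comm)
  have "symmetric (with_proj (eberhard_graph p))"
    unfolding symmetric_def
  proof (rule symI)
    fix u v
    assume "(u, v) \<in> arcs_ends (with_proj (eberhard_graph p))"
    then have uv: "u \<in> carrier F \<times> carrier F" "v \<in> carrier F \<times> carrier F"
      and d: "(fst u \<ominus>\<^bsub>F\<^esub> fst v, snd u \<ominus>\<^bsub>F\<^esub> snd v) \<in> eberhard_set p"
      by (auto simp: A)
    have "fst v \<ominus>\<^bsub>F\<^esub> fst u = \<ominus>\<^bsub>F\<^esub> (fst u \<ominus>\<^bsub>F\<^esub> fst v)"
      "snd v \<ominus>\<^bsub>F\<^esub> snd u = \<ominus>\<^bsub>F\<^esub> (snd u \<ominus>\<^bsub>F\<^esub> snd v)"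
      using uv by (auto intro!: diff)
    then show "(v, u) \<in> arcs_ends (with_proj (eberhard_graph p))"
      using uv neg[OF d] by (simp add: A)
  qed
  moreover have "finite (parcs (eberhard_graph p))"
    by (rule finite_subset[of _ "(carrier F \<times> carrier F) \<times> (carrier F \<times> carrier F)"])
      (auto simp: A fin)
  moreover have "fst e \<noteq> snd e" if "e \<in> parcs (eberhard_graph p)" for e
    using that by (auto simp: A S minus_eq r_neg)
  ultimately show ?thesis
    by unfold_locales (auto simp: V A fin)
qed

end

theory Submission
  imports Defs
begin

text \<open>
  The steps \<open>(1, 1)\<close> and \<open>(1, -1)\<close> trace out a Hamiltonian path of \<open>G\<close>, and pairing consecutive
  vertices of it colours the complement with \<open>(p\<^sup>2 + 1) / 2\<close> colours. It remains to partition the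
  vertices into one singleton and pairs that are non-edges of \<open>G\<close>, no two parts being completely
  joined in \<open>G\<close>.

  Two vertices \<open>(x, y)\<close>, \<open>(x, z)\<close> of one column are not adjacent, and a common neighbour \<open>(a, b)\<close>
  satisfies \<open>{y - b, z - b} = {(x - a)\<^sup>2, -(x - a)\<^sup>2}\<close>, so \<open>y + z = 2b\<close>. Hence such a column pair is
  not completely joined to any pair with distinct second coordinates, in particular not to another
  column pair. Pair each column \<open>x\<close> by reflection in a centre \<open>c x\<close>, where \<open>c\<close> is 0 at the origin, 1
  at odd \<open>x\<close> and 3 at even \<open>x\<close>. The origin is the singleton, and the remaining centres are paired as
  \<open>(x, 1)\<close>, \<open>(x + 1, 3)\<close> with \<open>x\<close> odd.
\<close>

section \<open>Complete models from involutions of the vertex set\<close>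

lemma chromatic_number_le:
  assumes "proper_colouring G k c"
  shows "chromatic_number G \<le> k"
  unfolding chromatic_number_def using assms by (intro Least_le) blast

text \<open>The arc is demanded only for distinct vertices, so the singleton orbit of a fixed point
  is covered as well.\<close>

lemma connected_induce_pair:
  assumes "u \<noteq> v \<Longrightarrow> (u, v) \<in> parcs G"
  shows "connected (with_proj G \<restriction> {u, v})"
proof -
  let ?K = "with_proj (mk_symmetric (with_proj G \<restriction> {u, v}))"
  have "u \<rightarrow>\<^sup>*\<^bsub>?K\<^esub> u" "v \<rightarrow>\<^sup>*\<^bsub>?K\<^esub> v"
    by (simp_all add: reachable_def)
  moreover have "u \<rightarrow>\<^sup>*\<^bsub>?K\<^esub> v" "v \<rightarrow>\<^sup>*\<^bsub>?K\<^esub> u" if "u \<noteq> v"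
    using assms[OF that]
    by (auto simp: reachable_def mk_symmetric_def intro!: rtrancl_on_into_rtrancl_on[OF rtrancl_on_refl])
  ultimately show ?thesis
    unfolding connected_def strongly_connected_def by auto
qed

text \<open>Branch sets can be discarded, so an upper bound on the chromatic number suffices; its
  exact value is never computed.\<close>

lemma complete_model_subset:
  assumes "complete_model G t \<B>" "s \<le> t"
  obtains \<C> where "\<C> \<subseteq> \<B>" "complete_model G s \<C>"
proof -
  obtain \<C> where "\<C> \<subseteq> \<B>" "finite \<C>" "card \<C> = s"
    using assms obtain_subset_with_card_n unfolding complete_model_def by metis
  with assms(1) have "complete_model G s \<C>"
    unfolding complete_model_def by (meson subsetD)
  with \<open>\<C> \<subseteq> \<B>\<close> that show ?thesis by blast
qed

text \<open>The sets other than \<open>{z}\<close> have at most two elements each and, together with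
  \<open>z\<close>, cover \<open>V\<close>.\<close>

lemma card_involution_orbits:
  assumes "finite V" and "z \<in> V" and "f z = z"
  shows "card V + 1 \<le> 2 * card ((\<lambda>v. {v, f v}) ` V)"
proof -
  let ?O = "(\<lambda>v. {v, f v}) ` V"
  have fin: "finite ?O" using assms(1) by simp
  have z: "{z} \<in> ?O" using assms(2,3) by force
  have "V \<subseteq> insert z (\<Union>(?O - {{z}}))" by auto
  then have "card V \<le> card (insert z (\<Union>(?O - {{z}})))"
    by (rule card_mono[rotated]) (use fin in auto)
  also have "\<dots> \<le> Suc (card (\<Union>(?O - {{z}})))"
    by (rule card_insert_le_m1) simp_all
  also have "\<dots> \<le> Suc (\<Sum>B \<in> ?O - {{z}}. card B)"
    using card_Union_le_sum_card[of "?O - {{z}}"] by auto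
  also have "\<dots> \<le> Suc (\<Sum>B \<in> ?O - {{z}}. 2)"
  proof (intro Suc_le_mono[THEN iffD2] sum_mono)
    fix B assume "B \<in> ?O - {{z}}"
    then obtain v where "B = {v, f v}" by blast
    then show "card B \<le> 2" by (simp add: card_insert_if)
  qed
  also have "\<dots> = Suc (2 * (card ?O - 1))"
    using fin z by simp
  finally show ?thesis
    using z fin card_gt_0_iff[of ?O] by fastforce
qed

text \<open>The branch sets are the orbits of \<open>f\<close>, which partition \<open>V\<close>. By
  \<open>edge\<close> each orbit is connected in the complement, and by \<open>joined\<close> any
  two orbits have a complement edge between them.\<close>

lemma complete_model_involution:
  assumes "pair_graph G" and V: "V = pverts G"
    and inv: "\<And>v. v \<in> V \<Longrightarrow> f v \<in> V" "\<And>v. v \<in> V \<Longrightarrow> f (f v) = v"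
    and edge: "\<And>v. v \<in> V \<Longrightarrow> (v, f v) \<notin> parcs G"
    and joined: "\<And>v w. \<lbrakk>v \<in> V; w \<in> V; \<forall>a \<in> {v, f v}. \<forall>b \<in> {w, f w}. (a, b) \<in> parcs G\<rbrakk> \<Longrightarrow> False"
    and z: "z \<in> V" "f z = z"
    and t: "2 * t \<le> card V + 1"
  shows "\<exists>\<B>. complete_model (complement_graph G) t \<B> \<and> (\<forall>B \<in> \<B>. card B \<le> 2)"
proof -
  interpret pair_graph G by fact
  let ?O = "(\<lambda>v. {v, f v}) ` V"
  have fin: "finite V" using V pair_finite_verts by simp
  have orbit: "{a, f a} = {v, f v}" if "v \<in> V" "a \<in> {v, f v}" for v a
    using inv(2)[OF that(1)] that(2) by auto
  have disj: "{v, f v} \<inter> {w, f w} = {}" if "v \<in> V" "w \<in> V" "{v, f v} \<noteq> {w, f w}" for v w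
    using orbit[OF that(1)] orbit[OF that(2)] that(3) by (metis disjoint_iff)
  have "complete_model (complement_graph G) (card ?O) ?O"
    unfolding complete_model_def
  proof (intro conjI ballI impI)
    fix B C assume B: "B \<in> ?O" and C: "C \<in> ?O" and "B \<noteq> C"
    then obtain v w where vw: "v \<in> V" "w \<in> V" "B = {v, f v}" "C = {w, f w}" by auto
    with disj \<open>B \<noteq> C\<close> show dis: "B \<inter> C = {}" by blast
    from joined[OF vw(1,2)] vw obtain a b where ab: "a \<in> B" "b \<in> C" "(a, b) \<notin> parcs G" by auto
    then have "a \<in> V" "b \<in> V" "a \<noteq> b" using dis vw inv by auto
    with ab V show "\<exists>u\<in>B. \<exists>v\<in>C. (u, v) \<in> parcs (complement_graph G)"
      by (auto simp: complement_graph_def)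
  next
    fix B assume "B \<in> ?O"
    then obtain v where v: "v \<in> V" "B = {v, f v}" by auto
    with V inv show "B \<subseteq> pverts (complement_graph G)" by (auto simp: complement_graph_def)
    show "connected (with_proj (complement_graph G) \<restriction> B)"
      unfolding v(2) using v V inv edge
      by (intro connected_induce_pair) (auto simp: complement_graph_def)
  qed (use fin in auto)
  moreover have "t \<le> card ?O"
    using card_involution_orbits[of V z f] fin z t by linarith
  ultimately obtain \<C> where "\<C> \<subseteq> ?O" "complete_model (complement_graph G) t \<C>"
    by (rule complete_model_subset)
  moreover have "card B \<le> 2" if "B \<in> ?O" for B
    using that by (auto simp: card_insert_if)
  ultimately show ?thesis by blast
qed

section \<open>Adjacency as integer divisibility\<close>

lemma eberhard_verts: "pverts (eberhard_graph p) = {0..int p - 1} \<times> {0..int p - 1}"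
  by (simp add: eberhard_graph_def residue_ring_def Let_def)

lemma eberhard_arc_iff:
  assumes "1 < p"
  shows "((x, y), (x', y')) \<in> parcs (eberhard_graph p) \<longleftrightarrow>
    x \<in> {0..int p - 1} \<and> y \<in> {0..int p - 1} \<and> x' \<in> {0..int p - 1} \<and> y' \<in> {0..int p - 1} \<and>
    x \<noteq> x' \<and> (int p dvd y - y' - (x - x')\<^sup>2 \<or> int p dvd y - y' + (x - x')\<^sup>2)"
proof -
  define F where "F = residue_ring (int p)"
  interpret residues "int p" F
    using assms by unfold_locales (simp_all add: F_def)
  have minus: "a \<ominus>\<^bsub>F\<^esub> b = (a - b) mod int p" for a b
    by (simp add: a_minus_def res_add_eq res_neg_eq mod_add_right_eq)
  \<comment> \<open>Stated for arbitrary integers, because \<open>minus\<close> turns ring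
    differences of coordinates into remainders of integer differences.\<close>
  have S: "(a mod int p, b mod int p) \<in> eberhard_set p \<longleftrightarrow>
      \<not> int p dvd a \<and> (int p dvd b - a\<^sup>2 \<or> int p dvd b + a\<^sup>2)" for a b
  proof -
    have "(a mod int p, b mod int p) \<in> eberhard_set p \<longleftrightarrow> a mod int p \<noteq> 0 \<and>
      (b mod int p = (a mod int p) [^]\<^bsub>F\<^esub> (2::nat) \<or>
       b mod int p = \<ominus>\<^bsub>F\<^esub> ((a mod int p) [^]\<^bsub>F\<^esub> (2::nat)))"
      using assms by (auto simp: eberhard_set_def Let_def res_carrier_eq res_zero_eq simp flip: F_def)
    also have "\<dots> \<longleftrightarrow> \<not> int p dvd a \<and> (b mod int p = a\<^sup>2 mod int p \<or> b mod int p = (- a\<^sup>2) mod int p)"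
      by (simp add: pow_cong neg_cong mod_eq_0_iff_dvd)
    finally show ?thesis
      by (simp add: mod_eq_dvd_iff)
  qed
  have "int p dvd x - x' \<longleftrightarrow> x = x'" if "x \<in> {0..int p - 1}" "x' \<in> {0..int p - 1}"
    using that by (auto simp flip: mod_eq_dvd_iff)
  then show ?thesis
    unfolding eberhard_graph_def Let_def
    by (auto simp: minus S res_carrier_eq simp flip: F_def)
qed

section \<open>The Hamiltonian path and its colouring\<close>

text \<open>Cell \<open>x\<close> of row \<open>j\<close> gets number \<open>j * q + x\<close>, so
  the next number is either one cell to the right or the start of the next row. The row difference
  times \<open>q\<close> is \<open>x + 1 - x'\<close>, strictly between \<open>-q\<close> and
  \<open>2 * q\<close>.\<close>

lemma raster_successor:
  fixes q :: int
  assumes "0 \<le> x" "x < q" "0 \<le> x'" "x' < q" "j' * q + x' = j * q + x + 1"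
  shows "j' = j \<and> x' = x + 1 \<or> j' = j + 1 \<and> x' = 0 \<and> x = q - 1"
proof -
  have eq: "(j' - j) * q = x + 1 - x'" using assms(5) by (simp add: algebra_simps)
  have "j' - j > -1"
  proof (rule ccontr)
    assume "\<not> j' - j > -1"
    then have "(j' - j) * q \<le> (-1) * q" using assms by (intro mult_right_mono) auto
    with eq assms show False by simp
  qed
  moreover have "j' - j < 2"
  proof (rule ccontr)
    assume "\<not> j' - j < 2"
    then have "2 * q \<le> (j' - j) * q" using assms by (intro mult_right_mono) auto
    with eq assms show False by simp
  qed
  ultimately consider "j' - j = 0" | "j' - j = 1" by linarith
  then show ?thesis using eq assms by cases auto
qed

text \<open>For odd \<open>q\<close> the factor \<open>(q + 1) div 2\<close> is the inverse of 2, so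
  row \<open>j\<close> is the line y = x - 2j modulo \<open>q\<close>.\<close>

definition raster_row :: "int \<Rightarrow> int \<Rightarrow> int \<Rightarrow> int" where
  "raster_row q x y = ((x - y) * ((q + 1) div 2)) mod q"

lemma raster_row_double:
  assumes "odd q"
  shows "q dvd x - y - 2 * raster_row q x y"
proof -
  have "2 * ((q + 1) div 2) = q + 1" using assms by presburger
  then have "2 * ((x - y) * ((q + 1) div 2)) = (x - y) * (q + 1)"
    by (metis mult.left_commute)
  moreover obtain k where "(x - y) * ((q + 1) div 2) = raster_row q x y + q * k"
    unfolding raster_row_def by (metis mod_mult_div_eq)
  ultimately have "x - y - 2 * raster_row q x y = q * (2 * k - (x - y))"
    by (simp add: algebra_simps)
  then show ?thesis by simp
qed

text \<open>Inside a row the path moves by (1, 1). From the end of a row, (-1, -1 - 2j), to the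
  start of the next, (0, -2j - 2), it moves by (1, -1).\<close>

lemma raster_successor_adjacent:
  assumes "1 < p" "odd p"
    and in_range: "x \<in> {0..int p - 1}" "y \<in> {0..int p - 1}" "x' \<in> {0..int p - 1}" "y' \<in> {0..int p - 1}"
    and succ: "raster_row (int p) x' y' * int p + x' = raster_row (int p) x y * int p + x + 1"
  shows "((x, y), (x', y')) \<in> parcs (eberhard_graph p)"
proof -
  define q where "q = int p"
  have q: "1 < q" "odd q" using assms by (auto simp: q_def)
  let ?j = "raster_row q x y" and ?j' = "raster_row q x' y'"
  obtain k k' where k: "x - y - 2 * ?j = q * k" and k': "x' - y' - 2 * ?j' = q * k'"
    using raster_row_double[OF q(2)] by (meson dvd_def)
  consider "?j' = ?j" "x' = x + 1" | "?j' = ?j + 1" "x' = 0" "x = q - 1"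
    using raster_successor[of x q x' ?j' ?j] in_range succ unfolding q_def by fastforce
  then have "x \<noteq> x' \<and> (q dvd y - y' - (x - x')\<^sup>2 \<or> q dvd y - y' + (x - x')\<^sup>2)"
  proof cases
    case 1
    then have "(x - x')\<^sup>2 = 1" by simp
    moreover have "q * (k' - k) = q * k' - q * k" by (rule right_diff_distrib)
    ultimately have "y - y' + (x - x')\<^sup>2 = q * (k' - k)"
      using k k' 1 by linarith
    then have "q dvd y - y' + (x - x')\<^sup>2" by simp
    with 1 show ?thesis by simp
  next
    case 2
    \<comment> \<open>The column wraps from \<open>q - 1\<close> to 0, so the square is 1 only
      modulo \<open>q\<close>; the surplus enters the multiplier
      \<open>k' - k + 3 - q\<close>.\<close>
    have "(x - x')\<^sup>2 = q * q - 2 * q + 1"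
      unfolding 2(2,3) by (simp add: power2_eq_square algebra_simps)
    moreover have "q * (k' - k + 3 - q) = q * k' - q * k + 3 * q - q * q"
      by (simp add: algebra_simps)
    ultimately have "y - y' - (x - x')\<^sup>2 = q * (k' - k + 3 - q)"
      using k k' 2 by linarith
    then have "q dvd y - y' - (x - x')\<^sup>2" by simp
    with 2 q show ?thesis by simp
  qed
  with in_range assms(1) show ?thesis
    by (simp add: eberhard_arc_iff q_def)
qed

text \<open>Halving the position \<open>n\<close> on the path puts at most two vertices into a
  colour class. Two such vertices are consecutive, hence adjacent in the Eberhard graph and not in
  its complement.\<close>

lemma chromatic_number_complement_eberhard:
  assumes "1 < p" "odd p"
  shows "2 * chromatic_number (complement_graph (eberhard_graph p)) \<le> p * p + 1"
proof -
  define q where "q = int p"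
  have q: "1 < q" "odd q" using assms by (auto simp: q_def)
  define n where "n = (\<lambda>(x, y). raster_row q x y * q + x)"
  define c where "c = (\<lambda>v. nat (n v div 2))"
  let ?k = "(p * p + 1) div 2"
  have row: "0 \<le> raster_row q x y" "raster_row q x y \<le> q - 1" for x y
    using q by (auto simp: raster_row_def)
  have bound: "0 \<le> n (x, y) \<and> n (x, y) < q * q" if "x \<in> {0..q - 1}" for x y
  proof -
    have "raster_row q x y * q \<le> (q - 1) * q" using row q by (intro mult_right_mono) auto
    then show ?thesis using that row[of x y] q by (auto simp: n_def algebra_simps)
  qed
  have inj: "(x, y) = (x', y')"
    if xy: "x \<in> {0..q - 1}" "y \<in> {0..q - 1}" "x' \<in> {0..q - 1}" "y' \<in> {0..q - 1}"
      and eq: "n (x, y) = n (x', y')" for x y x' y'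
  proof -
    \<comment> \<open>The column is the remainder of the position; the row then gives
      \<open>x - y\<close>, and so \<open>y\<close>, modulo \<open>q\<close>.\<close>
    have "x = n (x, y) mod q" "x' = n (x', y') mod q"
      using xy by (auto simp: n_def)
    then have x: "x = x'" using eq by simp
    then have "raster_row q x y = raster_row q x' y'" using eq q by (simp add: n_def)
    then have "q dvd y - y'"
      using dvd_diff[OF raster_row_double[OF q(2), of x' y'] raster_row_double[OF q(2), of x y]] x
      by simp
    then have "y = y'" using xy by (auto simp flip: mod_eq_dvd_iff)
    with x show ?thesis by simp
  qed
  interpret G: pair_graph "eberhard_graph p" by (rule pair_graph_eberhard_graph[OF assms(1)])
  have adj: "(u, v) \<in> parcs (eberhard_graph p)"
    if uv: "u \<in> pverts (eberhard_graph p)" "v \<in> pverts (eberhard_graph p)" "u \<noteq> v"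
      and eq: "c u = c v" for u v
  proof -
    obtain x y x' y' where [simp]: "u = (x, y)" "v = (x', y')" by fastforce
    have r: "x \<in> {0..q - 1}" "y \<in> {0..q - 1}" "x' \<in> {0..q - 1}" "y' \<in> {0..q - 1}"
      using uv by (auto simp: eberhard_verts q_def)
    have "n u \<noteq> n v" using inj[OF r] uv(3) by auto
    moreover have "n u div 2 = n v div 2"
      using eq bound[OF r(1), of y] bound[OF r(3), of y']
      by (simp add: c_def pos_imp_zdiv_nonneg_iff nat_eq_iff split: if_splits)
    ultimately have "n v = n u + 1 \<or> n u = n v + 1" by presburger
    then consider "n v = n u + 1" | "n u = n v + 1" by blast
    then show ?thesis
    proof cases
      case 1
      then show ?thesis
        using raster_successor_adjacent[OF assms, of x y x' y'] r by (simp add: n_def q_def)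
    next
      case 2
      then have "(v, u) \<in> parcs (eberhard_graph p)"
        using raster_successor_adjacent[OF assms, of x' y' x y] r by (simp add: n_def q_def)
      then show ?thesis using G.arcs_symmetric by blast
    qed
  qed
  have "c v < ?k" if "v \<in> pverts (eberhard_graph p)" for v
  proof -
    obtain x y where v: "v = (x, y)" by fastforce
    then have "0 \<le> n v" "n v < int (p * p)"
      using bound[of x y] that by (auto simp: eberhard_verts q_def)
    \<comment> \<open>Positions run from 0 to \<open>2 * m\<close>, so the colours are 0 to
      \<open>m\<close>, and \<open>m + 1\<close> equals \<open>?k\<close>.\<close>
    moreover obtain m where "p * p = 2 * m + 1" using assms(2) by (metis even_mult_iff oddE)
    ultimately show ?thesis by (simp add: c_def)
  qed
  then have "proper_colouring (complement_graph (eberhard_graph p)) ?k c"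
    unfolding proper_colouring_def using adj by (fastforce simp: complement_graph_def)
  from chromatic_number_le[OF this] show ?thesis by linarith
qed

section \<open>Common neighbours of two vertices in a column\<close>

text \<open>Equal signs of \<open>D\<close> would force \<open>y\<close> and \<open>z\<close> to
  agree modulo \<open>p\<close>. With opposite signs, \<open>D\<close> cancels in the sum.\<close>

lemma column_pair_common_neighbour:
  assumes "1 < p" "y \<noteq> z"
    and "((x, y), (a, b)) \<in> parcs (eberhard_graph p)" "((x, z), (a, b)) \<in> parcs (eberhard_graph p)"
  shows "int p dvd y + z - 2 * b"
proof -
  define D where "D = (x - a)\<^sup>2"
  have r: "y \<in> {0..int p - 1}" "z \<in> {0..int p - 1}"
    and y: "int p dvd y - b - D \<or> int p dvd y - b + D"
    and z: "int p dvd z - b - D \<or> int p dvd z - b + D"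
    using assms by (auto simp: eberhard_arc_iff D_def)
  have nd: "\<not> int p dvd y - z"
    using r assms(2) by (auto simp flip: mod_eq_dvd_iff)
  have e: "y - z = (y - b - D) - (z - b - D)" "y - z = (y - b + D) - (z - b + D)"
    "y + z - 2 * b = (y - b - D) + (z - b + D)" "y + z - 2 * b = (y - b + D) + (z - b - D)"
    by auto
  from y z show ?thesis
  proof (elim disjE)
    assume "int p dvd y - b - D" "int p dvd z - b - D"
    with nd show ?thesis unfolding e(1) by (blast intro: dvd_diff)
  next
    assume "int p dvd y - b + D" "int p dvd z - b + D"
    with nd show ?thesis unfolding e(2) by (blast intro: dvd_diff)
  next
    assume "int p dvd y - b - D" "int p dvd z - b + D"
    then show ?thesis unfolding e(3) by (rule dvd_add)
  next
    assume "int p dvd y - b + D" "int p dvd z - b - D"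
    then show ?thesis unfolding e(4) by (rule dvd_add)
  qed
qed

lemma column_pair_common_neighbours_snd:
  assumes "1 < p" "odd p" "y \<noteq> z"
    and "((x, y), (a, b)) \<in> parcs (eberhard_graph p)" "((x, z), (a, b)) \<in> parcs (eberhard_graph p)"
    and "((x, y), (a', b')) \<in> parcs (eberhard_graph p)" "((x, z), (a', b')) \<in> parcs (eberhard_graph p)"
  shows "b = b'"
proof -
  have "int p dvd (y + z - 2 * b') - (y + z - 2 * b)"
    using assms by (intro dvd_diff column_pair_common_neighbour)
  then have "int p dvd 2 * (b - b')" by (simp add: algebra_simps)
  then have "int p dvd b - b'"
    using assms(2) coprime_dvd_mult_right_iff[of "int p" 2 "b - b'"] by simp
  moreover have "b \<in> {0..int p - 1}" "b' \<in> {0..int p - 1}"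
    using assms by (auto simp: eberhard_arc_iff)
  ultimately show ?thesis by (auto simp flip: mod_eq_dvd_iff)
qed

section \<open>The pairing of the vertices\<close>

text \<open>The levels 1 and 3 differ by 2, which is not plus or minus 1 modulo \<open>p\<close>, so
  neighbouring centres are not adjacent. With 1 and 2 they would be.\<close>

definition centre :: "int \<Rightarrow> int" where
  "centre x = (if x = 0 then 0 else if odd x then 1 else 3)"

definition partner :: "int \<Rightarrow> int \<times> int \<Rightarrow> int \<times> int" where
  "partner q = (\<lambda>(x, y).
    if y \<noteq> centre x then (x, (2 * centre x - y) mod q)
    else if x = 0 then (0, 0)
    else if odd x then (x + 1, 3) else (x - 1, 1))"

text \<open>As \<open>q\<close> is odd, the last column \<open>q - 1\<close> is even, so an odd
  column always has a column to its right.\<close>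

lemma partner_mem:
  assumes "5 < q" "odd q" "v \<in> {0..q - 1} \<times> {0..q - 1}"
  shows "partner q v \<in> {0..q - 1} \<times> {0..q - 1}"
proof -
  obtain x y where v: "v = (x, y)" by fastforce
  have "x + 1 \<le> q - 1" if "odd x"
    using that assms v by auto presburger
  moreover have "x - 1 \<ge> 0" if "x \<noteq> 0"
    using that assms v by auto
  ultimately show ?thesis
    using assms v by (auto simp: partner_def)
qed

text \<open>Modulo an odd \<open>q\<close>, reflection in the centre fixes only the centre. Thus
  \<open>z\<close> also avoids the centre, and a second application of \<open>partner\<close>
  reflects back to \<open>y\<close>.\<close>

lemma partner_column:
  assumes "5 < q" "odd q" "y \<in> {0..q - 1}" "y \<noteq> centre x"
  obtains z where "partner q (x, y) = (x, z)" "z \<noteq> y" "z \<noteq> centre x"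
    "q dvd y + z - 2 * centre x" "(2 * centre x - z) mod q = y"
proof -
  define z where "z = (2 * centre x - y) mod q"
  have c: "centre x \<in> {0..q - 1}" using assms(1) by (auto simp: centre_def)
  then have nd: "\<not> q dvd y - centre x"
    using assms by (auto simp flip: mod_eq_dvd_iff)
  obtain k where k: "2 * centre x - y = z + q * k"
    unfolding z_def by (metis mod_mult_div_eq)
  have "z \<noteq> y"
  proof
    assume "z = y"
    then have "2 * (y - centre x) = q * (- k)" using k by simp
    then have "q dvd 2 * (y - centre x)" by (metis dvd_triv_left)
    with nd assms(2) show False using coprime_dvd_mult_right_iff[of q 2 "y - centre x"] by simp
  qed
  moreover have "z \<noteq> centre x"
  proof
    assume "z = centre x"
    then have "y - centre x = q * (- k)" using k by simp
    with nd show False by (metis dvd_triv_left)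
  qed
  moreover have "y + z - 2 * centre x = q * (- k)" using k by simp
  then have "q dvd y + z - 2 * centre x" by (metis dvd_triv_left)
  moreover have "(2 * centre x - z) mod q = y"
  proof -
    have "2 * centre x - z = y + q * k" using k by simp
    then show ?thesis using assms(3) by simp
  qed
  moreover have "partner q (x, y) = (x, z)"
    using assms(4) by (simp add: partner_def z_def)
  ultimately show ?thesis using that by blast
qed

lemma partner_centre:
  assumes "x \<noteq> 0" "0 \<le> x"
  obtains a where "0 < a" "odd a" "{(x, centre x), partner q (x, centre x)} = {(a, 1), (a + 1, 3)}"
proof (cases "odd x")
  case True
  then have "{(x, centre x), partner q (x, centre x)} = {(x, 1), (x + 1, 3)}"
    using assms by (simp add: partner_def centre_def)
  with True assms that show ?thesis by force
next
  case False
  then have "{(x, centre x), partner q (x, centre x)} = {(x - 1, 1), (x - 1 + 1, 3)}"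
    using assms by (simp add: partner_def centre_def insert_commute)
  moreover have "0 < x - 1" "odd (x - 1)" using False assms by presburger+
  ultimately show ?thesis using that by blast
qed

lemma partner_partner:
  assumes "5 < q" "odd q" "v \<in> {0..q - 1} \<times> {0..q - 1}"
  shows "partner q (partner q v) = v"
proof -
  obtain x y where v: "v = (x, y)" by fastforce
  show ?thesis
  proof (cases "y = centre x")
    case True
    then show ?thesis
      using assms v by (auto simp: partner_def centre_def)
  next
    case False
    then obtain z where "partner q (x, y) = (x, z)" "z \<noteq> centre x" "(2 * centre x - z) mod q = y"
      using partner_column assms v by (metis mem_Sigma_iff)
    then show ?thesis by (simp add: v partner_def)
  qed
qed

lemma partner_not_adjacent:
  assumes "5 < p" "odd p" "v \<in> pverts (eberhard_graph p)"
  shows "(v, partner (int p) v) \<notin> parcs (eberhard_graph p)"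
proof -
  obtain x y where v: "v = (x, y)" by fastforce
  \<comment> \<open>These are the values of 2 and -2 plus or minus 1 that arise for the two centres
    of a pair.\<close>
  have nd: "\<not> int p dvd 1" "\<not> int p dvd 3" "\<not> int p dvd -1" "\<not> int p dvd -3"
    using assms(1) zdvd_imp_le[of "int p" 3] by auto
  show ?thesis
    using assms(1) nd by (auto simp: v partner_def centre_def eberhard_arc_iff)
qed

section \<open>No two parts are completely joined\<close>

text \<open>Common neighbours of a column pair share their second coordinate, which rules out every
  part of size two. There remains the origin, which would be a common neighbour only if
  \<open>2 * centre x\<close>, that is 2 or 6, vanished modulo \<open>p\<close>.\<close>

lemma column_pair_joined:
  assumes "prime p" "5 < p" "odd p"
    and v: "(x, y) \<in> pverts (eberhard_graph p)" "y \<noteq> centre x"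
    and w: "w \<in> pverts (eberhard_graph p)"
    and joined: "\<forall>s \<in> {(x, y), partner (int p) (x, y)}. \<forall>t \<in> {w, partner (int p) w}.
      (s, t) \<in> parcs (eberhard_graph p)"
  shows False
proof -
  have p: "1 < p" "5 < int p" "odd (int p)" using assms by auto
  obtain z where z: "partner (int p) (x, y) = (x, z)" "z \<noteq> y" "int p dvd y + z - 2 * centre x"
    using partner_column[OF p(2,3)] v by (metis eberhard_verts mem_Sigma_iff)
  have snd_eq: "snd s = snd t"
    if "s \<in> {w, partner (int p) w}" "t \<in> {w, partner (int p) w}" for s t
    using column_pair_common_neighbours_snd
        [OF p(1) assms(3) z(2)[symmetric], of x "fst s" "snd s" "fst t" "snd t"]
      joined that z(1) by (metis insertCI prod.collapse)
  obtain a b where ab: "w = (a, b)" by fastforce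
  consider "b \<noteq> centre a" | "b = centre a" "a \<noteq> 0" | "b = centre a" "a = 0" by blast
  then show False
  proof cases
    case 1
    then obtain c where "partner (int p) w = (a, c)" "c \<noteq> b"
      using partner_column[OF p(2,3)] w ab by (metis eberhard_verts mem_Sigma_iff)
    with snd_eq[of w "partner (int p) w"] ab show False by simp
  next
    case 2
    then show False
      using snd_eq[of w "partner (int p) w"] ab by (simp add: partner_def centre_def split: if_splits)
  next
    case 3
    then have w0: "w = (0, 0)" using ab by (simp add: centre_def)
    then have arcs: "((x, y), (0, 0)) \<in> parcs (eberhard_graph p)"
        "((x, z), (0, 0)) \<in> parcs (eberhard_graph p)"
      using joined z(1) by auto
    then have "int p dvd y + z"
      using column_pair_common_neighbour[OF p(1) z(2)[symmetric]] by fastforce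
    then have "int p dvd 2 * centre x"
      using dvd_diff[OF _ z(3), of "y + z"] by simp
    moreover have "x \<noteq> 0" using arcs(1) p(1) by (simp add: eberhard_arc_iff)
    ultimately have "int p dvd 2 \<or> int p dvd 6" by (auto simp: centre_def split: if_splits)
    then have "p dvd 2 \<or> p dvd 6" by (metis int_dvd_int_iff of_nat_numeral)
    then have "p dvd 2 * 3" using dvd_mult2[of p 2 3] by auto
    then have "p dvd 2 \<or> p dvd 3" using assms(1) prime_dvd_mult_iff by blast
    with assms(2) show False by (auto dest: dvd_imp_le)
  qed
qed

text \<open>Separates any two centre pairs, since each contains a vertex at level 1.\<close>

lemma level_not_adjacent:
  assumes "prime p"
  shows "((x, y), (x', y)) \<notin> parcs (eberhard_graph p)"
proof
  assume a: "((x, y), (x', y)) \<in> parcs (eberhard_graph p)"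
  have p: "1 < p" using assms prime_gt_1_nat by blast
  have "int p dvd (x - x')\<^sup>2" and ne: "x \<noteq> x'" and "x \<in> {0..int p - 1}" "x' \<in> {0..int p - 1}"
    using a p by (auto simp: eberhard_arc_iff)
  moreover have "prime (int p)" using assms by simp
  ultimately have "int p dvd x - x'" using prime_dvd_power by blast
  with \<open>x \<in> _\<close> \<open>x' \<in> _\<close> ne show False by (auto simp flip: mod_eq_dvd_iff)
qed

text \<open>Eliminates \<open>x\<close>: subtracting the two relations gives 2x = f - e - 1 modulo
  \<open>m\<close>, and squaring compares this with 4e. Up to sign the result is the resultant of
  the two quadratics.\<close>

lemma dvd_quadratic_resultant:
  fixes m x e f :: int
  assumes "m dvd x\<^sup>2 - e" "m dvd (x + 1)\<^sup>2 - f"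
  shows "m dvd 4 * e - (f - e - 1)\<^sup>2"
proof -
  have "4 * e - (f - e - 1)\<^sup>2 =
    ((x + 1)\<^sup>2 - f - (x\<^sup>2 - e)) * (2 * x + f - e - 1) - 4 * (x\<^sup>2 - e)"
    by (simp add: power2_eq_square algebra_simps)
  then show ?thesis
    using assms by (metis dvd_diff dvd_mult dvd_mult2)
qed

text \<open>Being joined means x^2 = e and (x + 1)^2 = f modulo \<open>p\<close> with e = 1 or -1
  and f = 3 or -3. The resultants are 3, -21 and -13, whose prime factors 3, 7 and 13 are not 11
  modulo 12.\<close>

lemma origin_centre_pair_not_joined:
  assumes "prime p" "[p = 11] (mod 12)"
    and "((0, 0), (x, 1)) \<in> parcs (eberhard_graph p)" "((0, 0), (x + 1, 3)) \<in> parcs (eberhard_graph p)"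
  shows False
proof -
  have p: "1 < p" using assms prime_gt_1_nat by blast
  have "int p dvd x\<^sup>2 + 1 \<or> int p dvd x\<^sup>2 - 1"
    using assms(3) p dvd_minus_iff[of "int p" "x\<^sup>2 + 1"]
    by (auto simp: eberhard_arc_iff algebra_simps)
  moreover have "int p dvd (x + 1)\<^sup>2 + 3 \<or> int p dvd (x + 1)\<^sup>2 - 3"
  proof -
    have "(0 - (x + 1))\<^sup>2 = (x + 1)\<^sup>2" by (simp add: power2_eq_square algebra_simps)
    moreover have "0 - 3 - (x + 1)\<^sup>2 = - ((x + 1)\<^sup>2 + 3)" "0 - 3 + (x + 1)\<^sup>2 = (x + 1)\<^sup>2 - 3" by simp_all
    ultimately show ?thesis
      using assms(4) p unfolding eberhard_arc_iff[OF p] by (metis dvd_minus_iff)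
  qed
  ultimately have "int p dvd 3 \<or> int p dvd 21 \<or> int p dvd 13"
    using dvd_quadratic_resultant[of "int p" x 1 3] dvd_quadratic_resultant[of "int p" x 1 "-3"]
      dvd_quadratic_resultant[of "int p" x "-1" 3] dvd_quadratic_resultant[of "int p" x "-1" "-3"]
    by auto
  then have d: "p dvd 3 \<or> p dvd 21 \<or> p dvd 13" by (metis int_dvd_int_iff of_nat_numeral)
  then have "p \<le> 21" by (auto dest: dvd_imp_le)
  moreover have "p mod 12 = 11" using assms(2) by (simp add: cong_def)
  ultimately have "p = 11" by presburger
  with d show False by simp
qed

theorem theorem3p22:
  fixes p :: nat
  assumes "prime p" and "[p = 11] (mod 12)"
  defines "H \<equiv> complement_graph (eberhard_graph p)"
  shows "\<exists>\<B>. complete_model H (chromatic_number H) \<B> \<and> (\<forall>B \<in> \<B>. card B \<le> 2)"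
proof -
  have mod: "p mod 12 = 11" using assms(2) by (simp add: cong_def)
  have p: "1 < p" "5 < p" "odd p" using mod by presburger+
  then have q: "5 < int p" "odd (int p)" by auto
  let ?G = "eberhard_graph p"
  interpret G: pair_graph ?G by (rule pair_graph_eberhard_graph[OF p(1)])
  have sym: "(b, a) \<in> parcs ?G" if "(a, b) \<in> parcs ?G" for a b
    using that G.arcs_symmetric by blast
  have loop: "(a, a) \<notin> parcs ?G" for a
    using G.pair_no_loops by fastforce
  have joined: False
    if v: "v \<in> pverts ?G" and w: "w \<in> pverts ?G"
      and all: "\<forall>a \<in> {v, partner (int p) v}. \<forall>b \<in> {w, partner (int p) w}. (a, b) \<in> parcs ?G" for v w
  proof -
    have all': "\<forall>a \<in> {w, partner (int p) w}. \<forall>b \<in> {v, partner (int p) v}. (a, b) \<in> parcs ?G"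
      using all sym by blast
    have v_centre: "snd v = centre (fst v)"
      using column_pair_joined[OF assms(1) p(2,3), of "fst v" "snd v" w] v w all by auto
    have w_centre: "snd w = centre (fst w)"
      using column_pair_joined[OF assms(1) p(2,3), of "fst w" "snd w" v] v w all' by auto
    \<comment> \<open>With column pairs excluded on both sides, only the origin and the centre pairs
      remain.\<close>
    have shape: "u = (0, 0) \<or> (\<exists>x. {u, partner (int p) u} = {(x, 1), (x + 1, 3)})"
      if "u \<in> pverts ?G" "snd u = centre (fst u)" for u
    proof (cases "fst u = 0")
      case True
      with that(2) show ?thesis by (simp add: prod_eq_iff centre_def)
    next
      case False
      moreover have "u = (fst u, centre (fst u))" "0 \<le> fst u"
        using that by (auto simp: prod_eq_iff eberhard_verts)
      ultimately show ?thesis by (metis partner_centre)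
    qed
    from shape[OF v v_centre] shape[OF w w_centre] show False
    proof (elim disjE exE)
      \<comment> \<open>\<open>joined\<close> also covers equal parts; here the absence of loops
        settles it.\<close>
      assume "v = (0, 0)" "w = (0, 0)"
      with all loop show False by auto
    next
      fix x assume "v = (0, 0)" "{w, partner (int p) w} = {(x, 1), (x + 1, 3)}"
      with all origin_centre_pair_not_joined[OF assms(1,2)] show False by auto
    next
      fix x assume "w = (0, 0)" "{v, partner (int p) v} = {(x, 1), (x + 1, 3)}"
      with all' origin_centre_pair_not_joined[OF assms(1,2)] show False by auto
    next
      fix x x' assume "{v, partner (int p) v} = {(x, 1), (x + 1, 3)}"
        "{w, partner (int p) w} = {(x', 1), (x' + 1, 3)}"
      with all level_not_adjacent[OF assms(1)] show False by auto
    qed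
  qed
  have t: "2 * chromatic_number H \<le> card (pverts ?G) + 1"
    using chromatic_number_complement_eberhard[OF p(1,3)]
    by (simp add: H_def eberhard_verts card_cartesian_product)
  show ?thesis
    unfolding H_def
  proof (rule complete_model_involution[OF G.pair_graph_axioms refl, of "partner (int p)" "(0, 0)"])
    show "(0, 0) \<in> pverts ?G" using p(1) by (simp add: eberhard_verts)
    show "partner (int p) (0, 0) = (0, 0)" by (simp add: partner_def centre_def)
  qed (use partner_mem[OF q] partner_partner[OF q] partner_not_adjacent[OF p(2,3)] joined t
      in \<open>simp_all add: eberhard_verts H_def\<close>)
qed

end
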